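(* For every $s\in\mathbb{C}\setminus\{1\}$, the series below converges and $$\zeta(s)=\frac{1}{s-1}+1-\sum_{n=0}^\infty C_{n+1}\sum_{k=0}^{n}(-1)^k\binom{n}{k}(k+2)^{-s}.$$
   Context: $\zeta$ is the Riemann zeta-function. The normalized Cauchy numbers of the second kind $C_n$ ($n\ge1$) are defined by $\frac{z}{(1+z)\ln(1+z)}=1+\sum_{n=1}^\infty C_n(-z)^n$ for $|z|<1$; equivalently $C_n=\frac{1}{n!}\int_0^1 x(x+1)\cdots(x+n-1)\,dx$ (so $C_1=\tfrac12$, $C_2=\tfrac5{12}$, $C_3=\tfrac38$, ...). *)

theory Defs
  imports "HOL-Complex_Analysis.Complex_Analysis"
begin

text \<open>
  The Riemann zeta function is the analytic continuation of the Dirichlet series to the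
  punctured plane, which is unique since the punctured plane is connected. The value at the
  pole \<open>1\<close> is fixed to be \<open>0\<close> only so that the continuation is unique as a total function.
\<close>

definition riemann_zeta :: "complex \<Rightarrow> complex" where
  "riemann_zeta = (THE f. f holomorphic_on - {1} \<and> f 1 = 0 \<and>
     (\<forall>s. Re s > 1 \<longrightarrow> (\<lambda>n. 1 / of_nat (Suc n) powr s) sums f s))"

definition cauchy2_gf :: "complex \<Rightarrow> complex" where
  "cauchy2_gf z = (if z = 0 then 1 else z / ((1 + z) * Ln (1 + z)))"

text \<open>
  The normalized Cauchy numbers of the second kind are the Taylor coefficients of the generating
  function in powers of \<open>- z\<close>; that the expansion is valid on the whole unit disc is
  \<open>cauchy2_sums\<close> below. They are taken as complex numbers, although they are in fact rational.
\<close>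

definition cauchy2 :: "nat \<Rightarrow> complex" where
  "cauchy2 n = (- 1) ^ n * ((deriv ^^ n) cauchy2_gf 0 / fact n)"

lemma holomorphic_cauchy2_gf: "cauchy2_gf holomorphic_on ball 0 1"
proof (rule no_isolated_singularity'[where K = "{0}"])
  have ne: "1 + z \<notin> \<real>\<^sub>\<le>\<^sub>0" if "norm z < 1" for z :: complex
  proof
    assume "1 + z \<in> \<real>\<^sub>\<le>\<^sub>0"
    hence "Re z \<le> -1" by (auto simp: complex_nonpos_Reals_iff)
    thus False using abs_Re_le_cmod[of z] that by linarith
  qed
  have nz: "Ln (1 + z) \<noteq> 0" "1 + z \<noteq> 0" if "norm z < 1" "z \<noteq> 0" for z :: complex
  proof -
    show *: "1 + z \<noteq> 0" using ne[OF that(1)] by auto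
    show "Ln (1 + z) \<noteq> 0"
      using exp_Ln[OF *] that(2) by auto
  qed
  have "(\<lambda>z. z / ((1 + z) * Ln (1 + z))) holomorphic_on ball 0 1 - {0}"
    by (intro holomorphic_intros) (use ne nz in auto)
  thus "cauchy2_gf holomorphic_on ball 0 1 - {0}"
    by (rule holomorphic_transform) (auto simp: cauchy2_gf_def)
  have "((\<lambda>z. Ln (1 + z)) has_field_derivative 1) (at (0 :: complex))"
    by (auto intro!: derivative_eq_intros)
  hence "((\<lambda>z. Ln (1 + z) / z) \<longlongrightarrow> 1) (at (0 :: complex))"
    by (simp add: has_field_derivative_iff)
  hence "((\<lambda>z. inverse ((1 + z) * (Ln (1 + z) / z))) \<longlongrightarrow> inverse ((1 + 0) * 1)) (at (0 :: complex))"
    by (intro tendsto_intros) auto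
  moreover have "\<forall>\<^sub>F z in at 0. inverse ((1 + z) * (Ln (1 + z) / z)) = cauchy2_gf z"
    by (auto simp: eventually_at_filter cauchy2_gf_def field_simps)
  ultimately have "(cauchy2_gf \<longlongrightarrow> 1) (at 0)"
    by (simp add: tendsto_cong)
  hence "(cauchy2_gf \<longlongrightarrow> cauchy2_gf 0) (at 0 within ball 0 1)"
    using at_within_open[of 0 "ball (0 :: complex) 1"] by (simp add: cauchy2_gf_def[of 0])
  thus "\<And>z. z \<in> {0} \<Longrightarrow> (cauchy2_gf \<longlongrightarrow> cauchy2_gf z) (at z within ball 0 1)"
    by simp
qed auto

lemma cauchy2_0: "cauchy2 0 = 1"
  by (simp add: cauchy2_def cauchy2_gf_def)

lemma cauchy2_sums:
  assumes "norm z < 1" "z \<noteq> 0"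
  shows "(\<lambda>n. cauchy2 n * (- z) ^ n) sums (z / ((1 + z) * Ln (1 + z)))"
proof -
  have "(\<lambda>n. (deriv ^^ n) cauchy2_gf 0 / fact n * (z - 0) ^ n) sums cauchy2_gf z"
    by (rule holomorphic_power_series[OF holomorphic_cauchy2_gf]) (use assms in auto)
  moreover have "cauchy2 n * (- z) ^ n = (deriv ^^ n) cauchy2_gf 0 / fact n * (z - 0) ^ n" for n
  proof -
    have "(- 1) ^ n * (- z) ^ n = z ^ n"
      by (metis mult_minus1 minus_minus power_mult_distrib)
    thus ?thesis by (simp add: cauchy2_def mult.commute mult.left_commute)
  qed
  ultimately show ?thesis
    using assms by (simp add: cauchy2_gf_def)
qed

end

theory Submission
  imports Defs
begin

text \<open>
  For \<open>Re s > 0\<close>, expanding \<open>(1 - e\<^sup>-\<^sup>t)\<^sup>n\<close> shows that \<open>\<Gamma>(s)\<close> times the inner sum is the integral of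
  \<open>t powr (s - 1) e\<^sup>-\<^sup>2\<^sup>t (1 - e\<^sup>-\<^sup>t)\<^sup>n\<close> over \<open>t > 0\<close>. For \<open>Re s > 1\<close> one may sum over \<open>n\<close> under the integral;
  the generating function at \<open>z = e\<^sup>-\<^sup>t - 1\<close> turns the integrand into
  \<open>t powr (s - 1) (e\<^sup>-\<^sup>t / t - e\<^sup>-\<^sup>2\<^sup>t / (1 - e\<^sup>-\<^sup>t))\<close>, whose integral is
  \<open>\<Gamma>(s - 1) - \<Gamma>(s) (\<zeta>(s) - 1)\<close>.

  The series is entire in \<open>s\<close>: the Cauchy numbers are bounded by \<open>1\<close>, and the sums with \<open>2\<close> replaced
  by \<open>m\<close> are \<open>O(n powr (1/2 - m))\<close> locally uniformly, first for \<open>Re s > 0\<close> by the integral and then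
  everywhere by a recursion that moves \<open>s\<close> to \<open>s + 1\<close>. So the identity extends to all
  \<open>s \<noteq> 1\<close>, and the same series provides the continuation that defines \<open>\<zeta>\<close>.
\<close>

section \<open>Recurrence and bound for the Cauchy numbers\<close>

text \<open>Compare the coefficients of \<open>z ^ Suc n\<close> in
  \<open>cauchy2_gf z * Ln (1 + z) = z / (1 + z)\<close>, read as an identity of formal power
  series. Both sides carry the same sign \<open>(- 1) ^ n\<close>.\<close>

lemma cauchy2_convolution:
  "(\<Sum>i=0..n. cauchy2 i / of_nat (Suc (n - i))) = 1"
proof -
  define G where "G = fps_expansion cauchy2_gf 0"
  have G: "cauchy2_gf has_fps_expansion G"
    unfolding G_def using holomorphic_cauchy2_gf by (intro has_fps_expansion_fps_expansion[of "ball 0 1"]) auto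
  have G_nth: "fps_nth G i = (-1) ^ i * cauchy2 i" for i
    by (simp add: G_def fps_expansion_def cauchy2_def flip: power_mult_distrib mult.assoc)
  have L: "(\<lambda>z. Ln (1 + z)) has_fps_expansion fps_ln 1"
  proof (rule has_fps_expansionI)
    have "eventually (\<lambda>z::complex. z \<in> ball 0 1) (nhds 0)"
      by (rule eventually_nhds_in_open) auto
    thus "\<forall>\<^sub>F u in nhds 0. (\<lambda>n. fps_nth (fps_ln 1) n * u ^ n) sums Ln (1 + u)"
    proof eventually_elim
      case (elim u)
      hence "(\<lambda>n. (- 1) ^ Suc n / of_nat n * u ^ n) sums Ln (1 + u)"
        by (intro Ln_series) auto
      \<comment> \<open>At \<open>n = 0\<close> both coefficients are 0: on the left because
        division by zero yields 0, on the right because \<open>fps_ln 1\<close> has no constant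
        term.\<close>
      moreover have "(- 1) ^ Suc n / of_nat n * u ^ n = fps_nth (fps_ln 1) n * u ^ n" for n
        by (cases n) (auto simp: fps_ln_nth)
      ultimately show ?case by simp
    qed
  qed
  have exp: "(\<lambda>z. (cauchy2_gf z * (1 + z)) * Ln (1 + z)) has_fps_expansion (G * (1 + fps_X)) * fps_ln 1"
    by (intro has_fps_expansion_mult G L fps_expansion_intros)
  have ev: "eventually (\<lambda>z. (cauchy2_gf z * (1 + z)) * Ln (1 + z) = z) (nhds 0)"
  proof -
    have "eventually (\<lambda>z::complex. z \<in> ball 0 1) (nhds 0)"
      by (rule eventually_nhds_in_open) auto
    thus ?thesis
    proof eventually_elim
      case (elim z)
      have nz: "1 + z \<noteq> 0"
        using elim by (metis add_eq_0_iff dist_0_norm mem_ball norm_minus_cancel norm_one less_irrefl)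
      have "Ln (1 + z) \<noteq> 0" if "z \<noteq> 0"
        using exp_Ln[OF nz] that by auto
      thus ?case using nz by (auto simp: cauchy2_gf_def)
    qed
  qed
  have "(\<lambda>z. z) has_fps_expansion (G * (1 + fps_X)) * fps_ln 1"
    using exp has_fps_expansion_cong[OF ev refl] by simp
  from fps_expansion_unique_complex[OF this has_fps_expansion_fps_X]
  have "(1 + fps_X) * (G * fps_ln 1) = fps_X" by (simp add: algebra_simps)
  hence H: "G * fps_ln 1 * (1 + fps_X) = fps_X" by (simp add: mult_ac)
  have inv: "(1 + fps_X) * inverse (1 + fps_X :: complex fps) = 1"
    by (rule inverse_mult_eq_1') simp
  have "G * fps_ln 1 = G * fps_ln 1 * ((1 + fps_X) * inverse (1 + fps_X))"
    by (simp only: inv mult_1_right)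
  also have "\<dots> = fps_X * inverse (1 + fps_X)"
    by (simp only: H flip: mult.assoc)
  finally have "fps_nth (G * fps_ln 1) (Suc n) = fps_nth (fps_X * inverse (1 + fps_X)) (Suc n)" by simp
  also have "\<dots> = (-1) ^ n"
    by (simp add: fps_inverse_fps_X_plus1)
  \<comment> \<open>The product has one more summand, at index \<open>Suc n\<close>, which vanishes
    because the constant term of \<open>fps_ln 1\<close> is 0. The signs combine as
    \<open>(- 1) ^ i * (- 1) ^ (n - i)\<close>.\<close>
  also have "fps_nth (G * fps_ln 1) (Suc n) = (\<Sum>i=0..n. (-1) ^ n * (cauchy2 i / of_nat (Suc (n - i))))"
    unfolding fps_mult_nth sum.atLeast0_atMost_Suc
    by (auto simp: fps_ln_nth G_nth Suc_diff_le intro!: sum.cong simp flip: power_add)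
  also have "\<dots> = (-1) ^ n * (\<Sum>i=0..n. cauchy2 i / of_nat (Suc (n - i)))"
    by (simp add: sum_distrib_left)
  finally show ?thesis by simp
qed

text \<open>A uniform bound on the coefficients is enough for convergence, since the binomial sums
  supply the decay in \<open>n\<close>.\<close>

lemma norm_cauchy2_le_1: "norm (cauchy2 n) \<le> 1"
proof (induction n rule: less_induct)
  case (less n)
  show ?case
  proof (cases n)
    case 0
    thus ?thesis by (simp add: cauchy2_0)
  next
    case (Suc m)
    have "(\<Sum>i=0..Suc m. cauchy2 i / of_nat (Suc (Suc m - i))) =
        (\<Sum>i=0..m. cauchy2 i / of_nat (Suc (Suc (m - i)))) + cauchy2 n"
      unfolding sum.atLeast0_atMost_Suc
      by (intro arg_cong2[where f = "(+)"] sum.cong) (auto simp: Suc Suc_diff_le)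
    \<comment> \<open>The convolution sums up to \<open>m\<close> and up to \<open>Suc m\<close> are
      both 1. Their difference isolates \<open>cauchy2 n\<close>, which enters the longer one with
      weight 1.\<close>
    hence "cauchy2 n = (\<Sum>i=0..m. cauchy2 i / of_nat (Suc (m - i)))
        - (\<Sum>i=0..m. cauchy2 i / of_nat (Suc (Suc (m - i))))"
      unfolding cauchy2_convolution by (simp add: algebra_simps)
    \<comment> \<open>The weights are positive and telescope to less than \<open>1\<close>, so the bound is inherited.\<close>
    also have "\<dots> = (\<Sum>i=0..m. cauchy2 i * of_real (1 / real (Suc (m - i)) - 1 / real (Suc (Suc (m - i)))))"
      unfolding sum_subtractf[symmetric]
      by (intro sum.cong refl) (simp add: right_diff_distrib divide_inverse)
    also have "norm \<dots> \<le> (\<Sum>i=0..m. 1 / real (Suc (m - i)) - 1 / real (Suc (Suc (m - i))))"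
    proof (rule sum_norm_le)
      fix i assume "i \<in> {0..m}"
      hence "norm (cauchy2 i) \<le> 1" using less Suc by auto
      moreover have "1 / real (Suc (m - i)) - 1 / real (Suc (Suc (m - i))) \<ge> 0"
        by (simp add: field_simps)
      ultimately show "norm (cauchy2 i * of_real (1 / real (Suc (m - i)) - 1 / real (Suc (Suc (m - i)))))
            \<le> 1 / real (Suc (m - i)) - 1 / real (Suc (Suc (m - i)))"
        unfolding norm_mult norm_of_real by (simp add: mult_left_le_one_le)
    qed
    also have "\<dots> = (\<Sum>i=0..m. 1 / real (Suc i) - 1 / real (Suc (Suc i)))"
      by (rule sum.reindex_bij_witness[of _ "\<lambda>i. m - i" "\<lambda>i. m - i"]) auto
    also have "\<dots> = 1 - 1 / real (Suc (Suc m))"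
      by (induction m) auto
    also have "\<dots> \<le> 1" by simp
    finally show ?thesis .
  qed
qed

section \<open>The inner sums and their shift in \<open>s\<close>\<close>

text \<open>Up to the sign \<open>(- 1) ^ n\<close> this is the \<open>n\<close>-th forward
  difference of \<open>x powr (- s)\<close> at \<open>x = m\<close>. The theorem has
  \<open>m = 2\<close>; the start is a parameter because the recursion in \<open>s\<close> raises
  it.\<close>

definition binomial_powr_sum :: "nat \<Rightarrow> nat \<Rightarrow> complex \<Rightarrow> complex" where
  "binomial_powr_sum m n s = (\<Sum>k=0..n. (- 1) ^ k * of_nat (n choose k) * of_nat (k + m) powr (- s))"

lemma holomorphic_binomial_powr_sum [holomorphic_intros]:
  "binomial_powr_sum m n holomorphic_on A"
  unfolding binomial_powr_sum_def by (intro holomorphic_intros)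

text \<open>
  The factor \<open>n\<close> on the right is harmless since the sum next to it starts at \<open>m + 1\<close> and
  therefore decays one power of \<open>n\<close> faster.
\<close>

lemma binomial_powr_sum_shift:
  assumes "m > 0"
  shows "binomial_powr_sum m n s = of_nat m * binomial_powr_sum m n (s + 1) - of_nat n * binomial_powr_sum (Suc m) (n - 1) (s + 1)"
proof -
  have *: "of_nat (k + m) powr (- s) = (of_nat m + of_nat k) * (of_nat (k + m) powr (- (s + 1)) :: complex)" for k
  proof -
    have "of_nat (k + m) powr (- s) = of_nat (k + m) powr (- (s + 1) + 1 :: complex)" by simp
    also have "\<dots> = of_nat (k + m) powr (- (s + 1)) * of_nat (k + m)"
      using assms by (subst powr_add) auto
    finally show ?thesis by (simp add: algebra_simps)
  qed
  have "binomial_powr_sum m n s = of_nat m * binomial_powr_sum m n (s + 1) +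
     (\<Sum>k=0..n. of_nat k * ((- 1) ^ k * of_nat (n choose k) * of_nat (k + m) powr (- (s + 1))))"
    unfolding binomial_powr_sum_def * by (simp add: algebra_simps sum.distrib sum_distrib_left)
  \<comment> \<open>Absorption, \<open>k * (n choose k) = n * (n - 1 choose k - 1)\<close>, followed
    by an index shift that turns the start \<open>m\<close> into \<open>Suc m\<close>. For
    \<open>n = 0\<close> both sides vanish, so the truncated \<open>n - 1\<close> is
    harmless.\<close>
  also have "(\<Sum>k=0..n. of_nat k * ((- 1) ^ k * of_nat (n choose k) * of_nat (k + m) powr (- (s + 1)))) =
     - of_nat n * binomial_powr_sum (Suc m) (n - 1) (s + 1)"
  proof (cases n)
    case (Suc p)
    have "of_nat (Suc k) * (of_nat (Suc p choose Suc k) :: complex) = of_nat (Suc p) * of_nat (p choose k)" for k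
      using Suc_times_binomial_eq[of p k] by (metis mult.commute of_nat_mult)
    hence eq: "of_nat (Suc k) * ((- 1) ^ Suc k * of_nat (Suc p choose Suc k) * of_nat (Suc k + m) powr (- (s + 1)))
        = - of_nat (Suc p) * ((-1) ^ k * of_nat (p choose k) * (of_nat (k + Suc m) powr (- (s + 1)) :: complex))" for k
      by (simp add: mult.assoc mult.left_commute del: of_nat_Suc binomial_Suc_Suc)
    show ?thesis
      unfolding Suc sum.atLeast0_atMost_Suc_shift binomial_powr_sum_def o_def eq
      by (simp add: sum_distrib_left del: of_nat_Suc binomial_Suc_Suc)
  qed auto
  finally show ?thesis by simp
qed

section \<open>Gamma integrals and decay of the inner sums\<close>

text \<open>Euler's integral for \<open>Gamma s\<close>, rescaled by \<open>t\<close> to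
  \<open>a * t\<close>.\<close>

lemma has_bochner_integral_Gamma:
  assumes "Re s > 0" "a > 0"
  shows "has_bochner_integral lborel
           (\<lambda>t. indicator {0<..} t *\<^sub>R (of_real t powr (s - 1) * of_real (exp (- a * t))))
           (Gamma s * of_real a powr (- s))"
proof -
  define f where "f = (\<lambda>t. indicator {0<..} t *\<^sub>R (complex_of_real t powr (s - 1) * of_real (exp (- t))))"
  have [measurable]: "f \<in> borel_measurable borel"
    unfolding f_def by measurable
  have f_eq: "f = (\<lambda>t. indicator {0<..} t *\<^sub>R (complex_of_real t powr (s - 1) / of_real (exp t)))"
    by (auto simp: f_def exp_minus field_simps)
  have int: "integrable lebesgue f"
    using absolutely_integrable_Gamma_integral'[OF assms(1)] by (simp add: f_eq set_integrable_def)
  have "integral\<^sup>L lebesgue f = Gamma s"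
    using set_lebesgue_integral_eq_integral(2)[OF absolutely_integrable_Gamma_integral'[OF assms(1)]]
          integral_unique[OF Gamma_integral_complex'[OF assms(1)]]
    by (simp add: f_eq set_lebesgue_integral_def)
  \<comment> \<open>\<open>f\<close> is Borel measurable, so the integral over the completed measure
    is also the one over \<open>lborel\<close>.\<close>
  hence "has_bochner_integral lborel f (Gamma s)"
    using int by (simp add: has_bochner_integral_iff integrable_completion integral_completion)
  hence "has_bochner_integral lborel (\<lambda>t. f (0 + a * t)) (Gamma s /\<^sub>R \<bar>a\<bar>)"
    using assms by (subst (asm) lborel_has_bochner_integral_real_affine_iff[where c = a and t = 0]) auto
  \<comment> \<open>The factor \<open>a powr (1 - s)\<close> cancels the power of \<open>a\<close>
    that the substitution leaves in \<open>(a * t) powr (s - 1)\<close>.\<close>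
  from has_bochner_integral_mult_right[OF this, of "of_real a powr (1 - s)"]
  have "has_bochner_integral lborel (\<lambda>t. of_real a powr (1 - s) * f (a * t))
      (of_real a powr (1 - s) * (Gamma s /\<^sub>R a))"
    using assms by simp
  also have "of_real a powr (1 - s) * (Gamma s /\<^sub>R a) = Gamma s * of_real a powr (- s)"
    using assms by (simp add: powr_diff powr_minus scaleR_conv_of_real divide_inverse)
  also have "(\<lambda>t. of_real a powr (1 - s) * f (a * t)) =
     (\<lambda>t. indicator {0<..} t *\<^sub>R (of_real t powr (s - 1) * of_real (exp (- a * t))))"
  proof
    fix t
    have "of_real a powr (1 - s) * of_real (a * t) powr (s - 1) = of_real t powr (s - 1)" if "t > 0"
    proof -
      have "of_real a powr (1 - s) * of_real (a * t) powr (s - 1) =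
            of_real a powr (1 - s) * of_real a powr (s - 1) * of_real t powr (s - 1)"
        using assms that by (simp add: powr_times_real)
      also have "of_real a powr (1 - s) * of_real a powr (s - 1) = (1 :: complex)"
        using assms by (simp flip: powr_add)
      finally show ?thesis by simp
    qed
    hence "of_real a powr (1 - s) * (of_real (a * t) powr (s - 1) * of_real (exp (- (a * t)))) =
          of_real t powr (s - 1) * complex_of_real (exp (- (a * t)))" if "t > 0"
      using that by (simp only: flip: mult.assoc)
    thus "of_real a powr (1 - s) * f (a * t) =
      indicator {0<..} t *\<^sub>R (of_real t powr (s - 1) * of_real (exp (- a * t)))"
      using assms by (auto simp: f_def indicator_def zero_less_mult_iff simp del: of_real_mult)
  qed
  finally show ?thesis .
qed

text \<open>Raise \<open>y / a \<le> exp (y / a)\<close> to the power \<open>a\<close>.\<close>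

lemma powr_le_powr_self_exp:
  assumes "a > 0" "y \<ge> (0 :: real)"
  shows "y powr a \<le> a powr a * exp y"
proof -
  have "y / a \<le> exp (y / a)"
    using exp_ge_add_one_self[of "y / a"] by linarith
  hence "y \<le> a * exp (y / a)"
    using assms by (simp add: field_simps)
  hence "y powr a \<le> (a * exp (y / a)) powr a"
    using assms by (intro powr_mono2) auto
  also have "\<dots> = a powr a * exp y"
    using assms by (simp add: powr_mult exp_powr_real)
  finally show ?thesis .
qed

text \<open>Put \<open>x = exp (- t)\<close> and \<open>N = n + 1\<close>. Then
  \<open>(1 - x) ^ n\<close> is at most \<open>exp 1 * exp (- (N * x))\<close>, and
  \<open>x powr a\<close> is at most \<open>a powr a * N powr (- a) * exp (N * x)\<close>, so the
  exponentials in \<open>N * x\<close> cancel. Taking \<open>a = m - 1/2\<close> instead of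
  \<open>m\<close> holds back a factor \<open>exp (- t / 2)\<close>, which keeps the bound
  integrable at infinity.\<close>

lemma exp_kernel_bound:
  assumes "m > 0" "t > 0"
  shows "exp (- real m * t) * (1 - exp (- t)) ^ n \<le>
           (exp 1 * (real m - 1/2) powr (real m - 1/2)) * real (n + 1) powr (1/2 - real m) * exp (- (1/2) * t)"
proof -
  define x a N where "x = exp (- t)" and "a = real m - 1/2" and "N = real (n + 1)"
  have x: "x > 0" "x < 1" using assms by (auto simp: x_def)
  have a: "a > 0" using assms by (auto simp: a_def)
  have N: "N > 0" by (simp add: N_def)
  have "exp (- real m * t) = x powr a * exp (- (1/2) * t)"
    by (simp add: x_def a_def exp_powr_real algebra_simps flip: exp_add)
  moreover have "(1 - x) ^ n \<le> exp 1 * exp (- (N * x))"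
  proof -
    have "(1 - x) ^ n \<le> exp (- x) ^ n"
      using x exp_ge_add_one_self[of "- x"] by (intro power_mono) auto
    also have "\<dots> = exp (- (real n * x))" by (simp flip: exp_of_nat_mult)
    \<comment> \<open>Here \<open>n * x = N * x - x\<close> with \<open>x < 1\<close>; this is the
      origin of the constant \<open>exp 1\<close>.\<close>
    also have "\<dots> \<le> exp (1 - N * x)" using x by (simp add: N_def algebra_simps)
    finally show ?thesis by (simp add: exp_diff exp_minus field_simps)
  qed
  moreover have "x powr a \<le> a powr a * N powr (- a) * exp (N * x)"
  proof -
    have "x powr a * N powr a \<le> a powr a * exp (N * x)"
      using powr_le_powr_self_exp[of a "N * x"] x a N by (simp add: powr_mult mult.commute)
    thus ?thesis using N by (simp add: powr_minus field_simps)
  qed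
  ultimately have "exp (- real m * t) * (1 - x) ^ n \<le>
      (a powr a * N powr (- a) * exp (N * x) * exp (- (1/2) * t)) * (exp 1 * exp (- (N * x)))"
    using x by (simp only:) (intro mult_mono, auto)
  also have "\<dots> = exp 1 * a powr a * N powr (- a) * exp (- (1/2) * t) * (exp (N * x) * exp (- (N * x)))"
    by (simp only: mult_ac)
  also have "exp (N * x) * exp (- (N * x)) = 1"
    by (simp flip: exp_add)
  finally show ?thesis by (simp add: x_def a_def N_def)
qed

lemma norm_of_real_powr_minus_1:
  assumes "t > 0"
  shows "norm (complex_of_real t powr (s - 1)) = t powr (Re s - 1)"
  using assms by (simp add: norm_powr_real_powr)

text \<open>The real part of the complex formula at real arguments; it evaluates integrals of
  norms.\<close>

lemma has_bochner_integral_Gamma_real: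
  assumes "\<sigma> > 0" "a > (0 :: real)"
  shows "has_bochner_integral lborel (\<lambda>t. indicator {0<..} t * (t powr (\<sigma> - 1) * exp (- a * t)))
           (Gamma \<sigma> * a powr (- \<sigma>))"
proof -
  have "has_bochner_integral lborel (\<lambda>t. Re (indicator {0<..} t *\<^sub>R
            (of_real t powr (of_real \<sigma> - 1) * of_real (exp (- a * t)))))
          (Re (Gamma (of_real \<sigma>) * of_real a powr (- of_real \<sigma>)))"
    using assms by (intro has_bochner_integral_Re has_bochner_integral_Gamma) auto
  also have "Re (Gamma (of_real \<sigma>) * of_real a powr (- of_real \<sigma>)) = Gamma \<sigma> * a powr (- \<sigma>)"
    using assms by (simp add: Gamma_complex_of_real powr_of_real flip: of_real_minus)
  also have "(\<lambda>t. Re (indicator {0<..} t *\<^sub>R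
            (of_real t powr (of_real \<sigma> - 1) * of_real (exp (- a * t))))) =
       (\<lambda>t. indicator {0<..} t * (t powr (\<sigma> - 1) * exp (- a * t)))"
  proof
    fix t :: real
    have "of_real t powr (of_real \<sigma> - 1) = complex_of_real (t powr (\<sigma> - 1))" if "t > 0"
      using that powr_of_real[of t "\<sigma> - 1"] by simp
    thus "Re (indicator {0<..} t *\<^sub>R
            (of_real t powr (of_real \<sigma> - 1) * of_real (exp (- a * t)))) =
            indicator {0<..} t * (t powr (\<sigma> - 1) * exp (- a * t))"
      by (cases "t > 0") auto
  qed
  finally show ?thesis .
qed

lemma has_bochner_integral_binomial_powr_sum:
  assumes "Re s > 0" "m > 0"
  shows "has_bochner_integral lborel
           (\<lambda>t. indicator {0<..} t *\<^sub>R (of_real t powr (s - 1) *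
              of_real (exp (- real m * t) * (1 - exp (- t)) ^ n)))
           (Gamma s * binomial_powr_sum m n s)"
proof -
  have "has_bochner_integral lborel
     (\<lambda>t. \<Sum>k=0..n. (- 1) ^ k * of_nat (n choose k) *
         (indicator {0<..} t *\<^sub>R (of_real t powr (s - 1) * of_real (exp (- real (k + m) * t)))))
     (\<Sum>k=0..n. (- 1) ^ k * of_nat (n choose k) * (Gamma s * of_real (real (k + m)) powr (- s)))"
    using assms
    by (intro has_bochner_integral_sum has_bochner_integral_mult_right has_bochner_integral_Gamma) auto
  also have "(\<Sum>k=0..n. (- 1) ^ k * of_nat (n choose k) * (Gamma s * of_real (real (k + m)) powr (- s)))
      = Gamma s * binomial_powr_sum m n s"
    by (simp add: binomial_powr_sum_def sum_distrib_left mult_ac)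
  also have "(\<lambda>t. \<Sum>k=0..n. (- 1) ^ k * of_nat (n choose k) *
         (indicator {0<..} t *\<^sub>R (of_real t powr (s - 1) * of_real (exp (- real (k + m) * t))))) =
      (\<lambda>t. indicator {0<..} t *\<^sub>R (of_real t powr (s - 1) *
              of_real (exp (- real m * t) * (1 - exp (- t)) ^ n)))"
  proof
    fix t :: real
    have "exp (- real m * t) * (1 - exp (- t)) ^ n = exp (- real m * t) * (\<Sum>k\<le>n. of_nat (n choose k) * (- exp (- t)) ^ k * 1 ^ (n - k))"
      by (subst binomial_ring[symmetric]) simp
    also have "\<dots> = (\<Sum>k=0..n. (- 1) ^ k * of_nat (n choose k) * (exp (- real m * t) * exp (- t) ^ k))"
      unfolding atLeast0AtMost sum_distrib_left by (intro sum.cong refl) (subst power_minus, simp add: mult_ac)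
    also have "\<dots> = (\<Sum>k=0..n. (- 1) ^ k * of_nat (n choose k) * exp (- real (k + m) * t))"
      by (intro sum.cong refl) (simp add: algebra_simps flip: exp_of_nat_mult exp_add)
    finally have eq: "exp (- real m * t) * (1 - exp (- t)) ^ n =
      (\<Sum>k=0..n. (- 1) ^ k * of_nat (n choose k) * exp (- real (k + m) * t))" .
    show "(\<Sum>k=0..n. (- 1) ^ k * of_nat (n choose k) *
         (indicator {0<..} t *\<^sub>R (of_real t powr (s - 1) * of_real (exp (- real (k + m) * t))))) =
      indicator {0<..} t *\<^sub>R (of_real t powr (s - 1) * complex_of_real (exp (- real m * t) * (1 - exp (- t)) ^ n))"
      unfolding eq of_real_sum sum_distrib_left scaleR_sum_right
      by (intro sum.cong refl) (simp add: scaleR_conv_of_real mult_ac)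
  qed
  finally show ?thesis .
qed

text \<open>Integrate \<open>exp_kernel_bound\<close> against \<open>t powr (Re s - 1)\<close>; the
  remaining \<open>exp (- t / 2)\<close> contributes the Gamma factor.\<close>

lemma integral_norm_binomial_powr_sum_le:
  assumes "Re s > 0" "m > 0"
  shows "(\<integral>t. norm (indicator {0<..} t *\<^sub>R (complex_of_real t powr (s - 1) *
              of_real (exp (- real m * t) * (1 - exp (- t)) ^ n))) \<partial>lborel) \<le>
         (exp 1 * (real m - 1/2) powr (real m - 1/2)) * real (n + 1) powr (1/2 - real m) *
         (Gamma (Re s) * (1/2) powr (- Re s))"
proof -
  let ?B = "(exp 1 * (real m - 1/2) powr (real m - 1/2)) * real (n + 1) powr (1/2 - real m)"
  have *: "has_bochner_integral lborel
      (\<lambda>t. ?B * (indicator {0<..} t * (t powr (Re s - 1) * exp (- (1/2) * t))))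
      (?B * (Gamma (Re s) * (1/2) powr (- Re s)))"
    using assms by (intro has_bochner_integral_mult_right has_bochner_integral_Gamma_real) auto
  have "(\<integral>t. norm (indicator {0<..} t *\<^sub>R (complex_of_real t powr (s - 1) *
              of_real (exp (- real m * t) * (1 - exp (- t)) ^ n))) \<partial>lborel) \<le>
        (\<integral>t. ?B * (indicator {0<..} t * (t powr (Re s - 1) * exp (- (1/2) * t))) \<partial>lborel)"
  proof (rule integral_mono)
    fix t :: real
    show "norm (indicator {0<..} t *\<^sub>R (complex_of_real t powr (s - 1) *
              of_real (exp (- real m * t) * (1 - exp (- t)) ^ n))) \<le>
          ?B * (indicator {0<..} t * (t powr (Re s - 1) * exp (- (1/2) * t)))"
    proof (cases "t > 0")
      case True
      have "norm (indicator {0<..} t *\<^sub>R (complex_of_real t powr (s - 1) *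
              of_real (exp (- real m * t) * (1 - exp (- t)) ^ n))) =
            t powr (Re s - 1) * (exp (- real m * t) * (1 - exp (- t)) ^ n)"
        using True unfolding norm_scaleR norm_mult norm_of_real by (simp add: norm_of_real_powr_minus_1)
      also have "\<dots> \<le> t powr (Re s - 1) * (?B * exp (- (1/2) * t))"
        using exp_kernel_bound[OF assms(2) True, of n] by (intro mult_left_mono) auto
      finally show ?thesis using True by (simp add: mult_ac)
    qed auto
  next
    show "integrable lborel (\<lambda>t. norm (indicator {0<..} t *\<^sub>R (complex_of_real t powr (s - 1) *
              of_real (exp (- real m * t) * (1 - exp (- t)) ^ n))))"
      using has_bochner_integral_binomial_powr_sum[OF assms, of n]
      by (intro integrable_norm) (auto simp only: has_bochner_integral_iff)
  next
    show "integrable lborel (\<lambda>t. ?B * (indicator {0<..} t * (t powr (Re s - 1) * exp (- (1/2) * t))))"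
      using * by (auto simp only: has_bochner_integral_iff)
  qed
  also have "\<dots> = ?B * (Gamma (Re s) * (1/2) powr (- Re s))"
    using * by (simp only: has_bochner_integral_iff)
  finally show ?thesis .
qed

text \<open>Each induction step moves the half-plane one unit to the left. The shift evaluates sums
  at \<open>s + 1\<close> with starts \<open>m\<close> and \<open>Suc m\<close>, so the hypothesis
  is needed for a translate of \<open>K\<close> and for both starts.\<close>

lemma binomial_powr_sum_bound:
  assumes "compact K" "\<And>s. s \<in> K \<Longrightarrow> Re s > - real p" "m > 0"
  shows "\<exists>B. \<forall>s\<in>K. \<forall>n. norm (binomial_powr_sum m n s) \<le> B * real (n + 1) powr (1/2 - real m)"
  using assms
proof (induction p arbitrary: K m)
  case 0
  \<comment> \<open>\<open>h\<close> collects the factors of the bound that depend on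
    \<open>s\<close>: the division by \<open>Gamma s\<close> and the Gamma factor of the norm
    integral. It is continuous, hence bounded on \<open>K\<close>.\<close>
  define h where "h = (\<lambda>s::complex. norm (rGamma s) * (Gamma (Re s) * (1/2) powr (- Re s)))"
  define C where "C = exp 1 * (real m - 1/2) powr (real m - 1/2)"
  have pos: "Re s > 0" if "s \<in> K" for s using 0 that by auto
  have "continuous_on K (\<lambda>s. Gamma (Re s))"
    by (intro continuous_on_compose2[OF continuous_on_Gamma[of "{0<..}"]] continuous_intros)
       (auto dest!: pos elim!: nonpos_Ints_cases)
  hence "continuous_on K h"
    unfolding h_def by (intro continuous_intros) auto
  hence "compact (h ` K)" using 0 by (intro compact_continuous_image)
  then obtain H where H: "\<And>s. s \<in> K \<Longrightarrow> norm (h s) \<le> H"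
    using compact_imp_bounded by (fastforce simp: bounded_iff)
  show ?case
  proof (intro exI[of _ "C * H"] ballI allI)
    fix s n assume s: "s \<in> K"
    have G: "Gamma s \<noteq> 0"
      using pos[OF s] by (auto simp: Gamma_eq_zero_iff elim!: nonpos_Ints_cases)
    let ?I = "\<lambda>t. indicator {0<..} t *\<^sub>R (complex_of_real t powr (s - 1) *
              of_real (exp (- real m * t) * (1 - exp (- t)) ^ n))"
    have "Gamma s * binomial_powr_sum m n s = integral\<^sup>L lborel ?I"
      using has_bochner_integral_binomial_powr_sum[OF pos[OF s] 0(3), of n]
      by (simp only: has_bochner_integral_iff)
    hence eq: "binomial_powr_sum m n s = rGamma s * integral\<^sup>L lborel ?I"
      using G by (simp add: rGamma_inverse_Gamma field_simps)
    have "norm (binomial_powr_sum m n s) \<le> norm (rGamma s) * (\<integral>t. norm (?I t) \<partial>lborel)"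
      by (simp only: eq norm_mult) (intro mult_left_mono integral_norm_bound norm_ge_zero)
    also have "\<dots> \<le> norm (rGamma s) * (C * real (n + 1) powr (1/2 - real m) *
         (Gamma (Re s) * (1/2) powr (- Re s)))"
      unfolding C_def by (intro mult_left_mono integral_norm_binomial_powr_sum_le pos s 0) auto
    also have "\<dots> = C * real (n + 1) powr (1/2 - real m) * h s"
      by (simp add: h_def mult_ac)
    also have "\<dots> \<le> C * real (n + 1) powr (1/2 - real m) * H"
      using H[OF s] by (intro mult_left_mono) (auto simp: C_def)
    finally show "norm (binomial_powr_sum m n s) \<le> C * H * real (n + 1) powr (1/2 - real m)"
      by (simp add: mult_ac)
  qed
next
  case (Suc p)
  define K' where "K' = (\<lambda>s. s + 1) ` K"
  have K': "compact K'" "\<And>s. s \<in> K' \<Longrightarrow> Re s > - real p"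
    unfolding K'_def using Suc.prems by (auto intro!: compact_continuous_image continuous_intros) force
  obtain B1 where B1: "\<And>s n. s \<in> K' \<Longrightarrow>
      norm (binomial_powr_sum m n s) \<le> B1 * real (n + 1) powr (1/2 - real m)"
    using Suc.IH[OF K' Suc.prems(3)] by blast
  obtain B2 where B2: "\<And>s n. s \<in> K' \<Longrightarrow>
      norm (binomial_powr_sum (Suc m) n s) \<le> B2 * real (n + 1) powr (1/2 - real (Suc m))"
    using Suc.IH[OF K', of "Suc m"] by blast
  \<comment> \<open>The two summands of the witness bound the two terms of the shift. The power of 2
    comes from replacing \<open>n\<close> by \<open>n + 1\<close>: for \<open>n > 0\<close>,
    \<open>n \<ge> (n + 1) / 2\<close>, and the exponent \<open>1/2 - m\<close> is negative.\<close>
  show ?case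
  proof (intro exI[of _ "real m * B1 + B2 * 2 powr (real m - 1/2)"] ballI allI)
    fix s n assume s: "s \<in> K"
    hence s': "s + 1 \<in> K'" by (auto simp: K'_def)
    have "B2 * real (0 + 1) powr (1/2 - real (Suc m)) \<ge> 0"
      using B2[OF s', of 0] norm_ge_zero by (rule order_trans[rotated])
    hence B2_nonneg: "B2 \<ge> 0" by simp
    have "norm (of_nat n * binomial_powr_sum (Suc m) (n - 1) (s + 1)) \<le>
        B2 * 2 powr (real m - 1/2) * real (n + 1) powr (1/2 - real m)"
    proof (cases "n = 0")
      case False
      have "norm (of_nat n * binomial_powr_sum (Suc m) (n - 1) (s + 1)) \<le>
          real n * (B2 * real n powr (1/2 - real (Suc m)))"
        using B2[OF s', of "n - 1"] False by (simp add: norm_mult mult_left_mono)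
      also have "\<dots> = B2 * (real n powr 1 * real n powr (1/2 - real (Suc m)))"
        using False by simp
      also have "\<dots> = B2 * real n powr (1/2 - real m)"
        by (simp only: flip: powr_add) simp
      also have "real n powr (1/2 - real m) \<le> (real (n + 1) / 2) powr (1/2 - real m)"
        using False Suc.prems(3) by (intro powr_mono2') auto
      also have "\<dots> = 2 powr (real m - 1/2) * real (n + 1) powr (1/2 - real m)"
        using powr_minus_divide[of 2 "1/2 - real m"] by (simp add: powr_divide)
      finally show ?thesis using B2_nonneg by (simp add: mult_left_mono mult.assoc)
    qed (use B2_nonneg in auto)
    moreover have "norm (of_nat m * binomial_powr_sum m n (s + 1)) \<le>
        real m * B1 * real (n + 1) powr (1/2 - real m)"
      using B1[OF s', of n] by (simp add: norm_mult mult_left_mono mult.assoc)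
    ultimately show "norm (binomial_powr_sum m n s) \<le>
        (real m * B1 + B2 * 2 powr (real m - 1/2)) * real (n + 1) powr (1/2 - real m)"
      unfolding binomial_powr_sum_shift[OF Suc.prems(3), of n s] distrib_right
      by (intro order_trans[OF norm_triangle_ineq4] add_mono)
  qed
qed

section \<open>The identity for \<open>Re s > 1\<close>\<close>

text \<open>Termwise integration of an absolutely convergent series, used both for the zeta tail and
  for the Cauchy series.\<close>

lemma has_bochner_integral_sums:
  fixes f :: "nat \<Rightarrow> 'a \<Rightarrow> 'b :: {banach, second_countable_topology}"
  assumes "\<And>i. has_bochner_integral M (f i) (I i)"
    and sums: "\<And>x. (\<lambda>i. f i x) sums g x"
    and "\<And>x. summable (\<lambda>i. norm (f i x))"
    and "summable (\<lambda>i. \<integral>x. norm (f i x) \<partial>M)"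
  shows "integrable M g" "I sums integral\<^sup>L M g"
proof -
  have f: "integrable M (f i)" "integral\<^sup>L M (f i) = I i" for i
    using assms(1) by (auto simp: has_bochner_integral_iff)
  have g: "g = (\<lambda>x. \<Sum>i. f i x)"
    using sums by (auto simp: sums_iff)
  show "integrable M g"
    unfolding g using assms f by (intro integrable_suminf) auto
  show "I sums integral\<^sup>L M g"
    using sums_integral[of M f] assms f unfolding g by simp
qed

text \<open>At \<open>z = - u\<close> with \<open>u = 1 - exp (- t)\<close> the logarithm is
  \<open>- t\<close>. Remove the constant term 1 from the generating function and divide by
  \<open>u\<close>.\<close>

lemma cauchy2_Suc_sums:
  assumes "t > (0 :: real)"
  shows "(\<lambda>n. cauchy2 (n + 1) * of_real ((1 - exp (- t)) ^ n)) sums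
           of_real (exp t / t - 1 / (1 - exp (- t)))"
proof -
  define u where "u = 1 - exp (- t)"
  have u: "u > 0" "u < 1" using assms by (auto simp: u_def)
  have Ln_eq: "Ln (of_real (exp (- t))) = of_real (- t)"
    by (subst Ln_of_real) auto
  have "(\<lambda>n. cauchy2 n * (- (- complex_of_real u)) ^ n) sums
          ((- of_real u) / ((1 + (- of_real u)) * Ln (1 + (- of_real u))))"
    using u by (intro cauchy2_sums) auto
  also have "1 + (- of_real u) = complex_of_real (exp (- t))"
    by (simp add: u_def)
  also have "- of_real u / (of_real (exp (- t)) * Ln (of_real (exp (- t)))) = complex_of_real (u * exp t / t)"
    unfolding Ln_eq using assms by (simp add: exp_minus field_simps)
  finally have "(\<lambda>n. cauchy2 (Suc n) * of_real u ^ Suc n) sums (of_real (u * exp t / t) - 1)"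
    by (subst sums_Suc_iff) (simp add: cauchy2_0)
  from sums_divide[OF this, of "of_real u"]
  have "(\<lambda>n. cauchy2 (Suc n) * of_real (u ^ n)) sums ((of_real (u * exp t / t) - 1) / of_real u)"
    using u by (simp add: mult.assoc)
  also have "(of_real (u * exp t / t) - 1) / of_real u = complex_of_real (exp t / t - 1 / u)"
    using u by (simp add: field_simps)
  finally show ?thesis by (simp add: u_def)
qed

lemma summable_real_Suc_powr:
  assumes "a < -1"
  shows "summable (\<lambda>n. real (n + 1) powr a)"
  unfolding Suc_eq_plus1[symmetric] using assms summable_real_powr_iff[of a]
  by (subst summable_Suc_iff) blast

text \<open>Expand \<open>1 / (1 - exp (- t))\<close> as a geometric series. \<open>Re s > 1\<close>
  makes the integrals of the norms, multiples of \<open>(k + 2) powr (- Re s)\<close>,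
  summable.\<close>

lemma zeta_tail_integral:
  assumes "Re s > 1"
  defines "g \<equiv> (\<lambda>t. indicator {0<..} t *\<^sub>R
             (of_real t powr (s - 1) * complex_of_real (exp (- 2 * t) / (1 - exp (- t)))))"
  shows "integrable lborel g"
    and "(\<lambda>k. Gamma s * of_nat (k + 2) powr (- s)) sums integral\<^sup>L lborel g"
proof -
  define f where "f = (\<lambda>k t. indicator {0<..} t *\<^sub>R
      (of_real t powr (s - 1) * complex_of_real (exp (- real (k + 2) * t))))"
  have int: "has_bochner_integral lborel (f k) (Gamma s * of_nat (k + 2) powr (- s))" for k
    using has_bochner_integral_Gamma[of s "real (k + 2)"] assms unfolding f_def by simp
  have exp_eq: "exp (- real (k + 2) * t) = exp (- 2 * t) * exp (- t) ^ k" for k t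
    by (simp add: algebra_simps flip: exp_of_nat_mult exp_add)
  have sums: "(\<lambda>k. f k t) sums g t" for t
  proof (cases "t > 0")
    case True
    have "(\<lambda>k. exp (- t) ^ k) sums (1 / (1 - exp (- t)))"
      using True by (intro geometric_sums) auto
    from sums_mult[OF this, of "exp (- 2 * t)"]
    have "(\<lambda>k. exp (- real (k + 2) * t)) sums (exp (- 2 * t) / (1 - exp (- t)))"
      unfolding exp_eq by simp
    hence "(\<lambda>k. complex_of_real (exp (- real (k + 2) * t))) sums of_real (exp (- 2 * t) / (1 - exp (- t)))"
      by (rule sums_of_real)
    thus ?thesis
      unfolding f_def g_def by (intro sums_scaleR_right sums_mult)
  qed (auto simp: f_def g_def)
  have norm_f: "norm (f k t) = indicator {0<..} t * (t powr (Re s - 1) * exp (- real (k + 2) * t))" for k t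
    unfolding f_def norm_scaleR norm_mult norm_of_real
    by (cases "t > 0") (auto simp: norm_of_real_powr_minus_1)
  have summable_norm: "summable (\<lambda>k. norm (f k t))" for t
  proof (cases "t > 0")
    case True
    thus ?thesis unfolding norm_f exp_eq
      by (intro summable_mult summable_geometric) auto
  qed (auto simp: norm_f)
  have "integral\<^sup>L lborel (\<lambda>t. norm (f k t)) = Gamma (Re s) * real (k + 2) powr (- Re s)" for k
    using has_bochner_integral_Gamma_real[of "Re s" "real (k + 2)"] assms unfolding norm_f
    by (simp only: has_bochner_integral_iff)
  moreover have "summable (\<lambda>k. Gamma (Re s) * real (k + 2) powr (- Re s))"
    using assms summable_iff_shift[of "\<lambda>n. real n powr (- Re s)" 2]
    by (intro summable_mult) (simp add: summable_real_powr_iff)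
  ultimately have summable_int: "summable (\<lambda>k. integral\<^sup>L lborel (\<lambda>t. norm (f k t)))" by simp
  note * = has_bochner_integral_sums[OF int sums summable_norm summable_int]
  show "integrable lborel g"
    and "(\<lambda>k. Gamma s * of_nat (k + 2) powr (- s)) sums integral\<^sup>L lborel g"
    using * by simp_all
qed

text \<open>\<open>Z\<close> stands for the zeta value minus 1. It cannot yet be expressed by
  \<open>riemann_zeta\<close>, a definite description whose existence is derived from this very
  series.\<close>

lemma cauchy2_series_eq_zeta:
  assumes "Re s > 1"
  shows "\<exists>Z. (\<lambda>k. of_nat (k + 2) powr (- s)) sums Z \<and>
             (\<lambda>n. cauchy2 (n + 1) * binomial_powr_sum 2 n s) sums (1 / (s - 1) - Z)"
proof -
  define g where "g = (\<lambda>t. indicator {0<..} t *\<^sub>R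
             (of_real t powr (s - 1) * complex_of_real (exp (- 2 * t) / (1 - exp (- t)))))"
  \<comment> \<open>The exponents keep the shape of \<open>has_bochner_integral_Gamma\<close> at
    \<open>s - 1\<close> and \<open>a = 1\<close>. \<open>h\<close> is the part of the integrand
    coming from \<open>exp t / t\<close>, and \<open>g\<close> the part from
    \<open>1 / (1 - exp (- t))\<close>.\<close>
  define h where "h = (\<lambda>t. indicator {0<..} t *\<^sub>R
             (of_real t powr (s - 1 - 1) * complex_of_real (exp (- 1 * t))))"
  define f where "f = (\<lambda>n t. cauchy2 (n + 1) * (indicator {0<..} t *\<^sub>R
      (of_real t powr (s - 1) * complex_of_real (exp (- real 2 * t) * (1 - exp (- t)) ^ n))))"
  have g: "integrable lborel g" "(\<lambda>k. Gamma s * of_nat (k + 2) powr (- s)) sums integral\<^sup>L lborel g"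
    using zeta_tail_integral[OF assms] unfolding g_def by blast+
  have h: "has_bochner_integral lborel h (Gamma (s - 1))"
    using has_bochner_integral_Gamma[of "s - 1" 1] assms unfolding h_def by simp
  have int: "has_bochner_integral lborel (f n) (cauchy2 (n + 1) * (Gamma s * binomial_powr_sum 2 n s))" for n
    unfolding f_def using assms
    by (intro has_bochner_integral_mult_right has_bochner_integral_binomial_powr_sum) auto
  have sums: "(\<lambda>n. f n t) sums (h t - g t)" for t
  proof (cases "t > 0")
    case True
    have "(\<lambda>n. of_real t powr (s - 1) * of_real (exp (- 2 * t)) *
                (cauchy2 (n + 1) * of_real ((1 - exp (- t)) ^ n))) sums
       (of_real t powr (s - 1) * of_real (exp (- 2 * t)) * of_real (exp t / t - 1 / (1 - exp (- t))))"
      by (intro sums_mult cauchy2_Suc_sums True)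
    also have "(\<lambda>n. of_real t powr (s - 1) * of_real (exp (- 2 * t)) *
                (cauchy2 (n + 1) * of_real ((1 - exp (- t)) ^ n))) = (\<lambda>n. f n t)"
      using True by (simp add: f_def mult_ac)
    also have "of_real t powr (s - 1) * of_real (exp (- 2 * t)) * of_real (exp t / t - 1 / (1 - exp (- t))) =
       of_real t powr (s - 1) * complex_of_real (exp (- 2 * t) * exp t / t) - g t"
      using True by (simp add: g_def right_diff_distrib mult.assoc)
    also have "exp (- 2 * t) * exp t = exp (- 1 * t)"
      by (simp flip: exp_add)
    also have "of_real t powr (s - 1) * complex_of_real (exp (- 1 * t) / t) = h t"
      using True unfolding h_def powr_diff[of _ "s - 1" 1] by simp
    finally show ?thesis .
  qed (auto simp: f_def g_def h_def)
  have norm_f: "norm (f n t) \<le> norm (indicator {0<..} t *\<^sub>R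
      (of_real t powr (s - 1) * complex_of_real (exp (- real 2 * t) * (1 - exp (- t)) ^ n)))" for n t
    unfolding f_def norm_mult[of "cauchy2 _"]
    by (rule mult_left_le_one_le) (use norm_cauchy2_le_1 in auto)
  have summable_norm: "summable (\<lambda>n. norm (f n t))" for t
  proof (cases "t > 0")
    case True
    have "summable (\<lambda>n. t powr (Re s - 1) * (exp (- real 2 * t) * (1 - exp (- t)) ^ n))"
      using True by (intro summable_mult summable_geometric) auto
    also have "(\<lambda>n. t powr (Re s - 1) * (exp (- real 2 * t) * (1 - exp (- t)) ^ n)) =
      (\<lambda>n. norm (indicator {0<..} t *\<^sub>R
         (of_real t powr (s - 1) * complex_of_real (exp (- real 2 * t) * (1 - exp (- t)) ^ n))))"
      using True unfolding norm_scaleR norm_mult norm_of_real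
      by (simp add: norm_of_real_powr_minus_1)
    finally show ?thesis
      by (rule summable_comparison_test'[where N = 0]) (use norm_f in simp)
  qed (auto simp: f_def)
  have int_bound: "integral\<^sup>L lborel (\<lambda>t. norm (f n t)) \<le>
     (exp 1 * (real 2 - 1/2) powr (real 2 - 1/2)) * real (n + 1) powr (1/2 - real 2) *
         (Gamma (Re s) * (1/2) powr (- Re s))" for n
  proof -
    have "integral\<^sup>L lborel (\<lambda>t. norm (f n t)) \<le> integral\<^sup>L lborel (\<lambda>t. norm (indicator {0<..} t *\<^sub>R
      (of_real t powr (s - 1) * complex_of_real (exp (- real 2 * t) * (1 - exp (- t)) ^ n))))"
    proof (rule integral_mono)
      show "integrable lborel (\<lambda>t. norm (f n t))"
        using int[of n] by (intro integrable_norm) (auto simp only: has_bochner_integral_iff)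
      show "integrable lborel (\<lambda>t. norm (indicator {0<..} t *\<^sub>R
          (of_real t powr (s - 1) * complex_of_real (exp (- real 2 * t) * (1 - exp (- t)) ^ n))))"
        using has_bochner_integral_binomial_powr_sum[of s 2 n] assms
        by (intro integrable_norm) (auto simp only: has_bochner_integral_iff)
    qed (rule norm_f)
    also have "\<dots> \<le> (exp 1 * (real 2 - 1/2) powr (real 2 - 1/2)) * real (n + 1) powr (1/2 - real 2) *
         (Gamma (Re s) * (1/2) powr (- Re s))"
      using assms by (intro integral_norm_binomial_powr_sum_le) auto
    finally show ?thesis .
  qed
  \<comment> \<open>The exponent is \<open>- 3/2\<close>, below the threshold \<open>- 1\<close>,
    because the sums start at 2.\<close>
  have "summable (\<lambda>n. (exp 1 * (real 2 - 1/2) powr (real 2 - 1/2)) * real (n + 1) powr (1/2 - real 2) *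
         (Gamma (Re s) * (1/2) powr (- Re s)))"
    by (intro summable_mult summable_mult2 summable_real_Suc_powr) auto
  hence summable_int: "summable (\<lambda>n. integral\<^sup>L lborel (\<lambda>t. norm (f n t)))"
    by (rule summable_comparison_test'[where N = 0]) (use int_bound in auto)
  have "(\<lambda>n. cauchy2 (n + 1) * (Gamma s * binomial_powr_sum 2 n s)) sums (integral\<^sup>L lborel (\<lambda>t. h t - g t))"
    by (rule has_bochner_integral_sums(2)[OF int sums summable_norm summable_int])
  also have "integral\<^sup>L lborel (\<lambda>t. h t - g t) = Gamma (s - 1) - integral\<^sup>L lborel g"
    using h g(1) by (simp add: has_bochner_integral_iff)
  finally have *: "(\<lambda>n. cauchy2 (n + 1) * (Gamma s * binomial_powr_sum 2 n s)) sums
      (Gamma (s - 1) - integral\<^sup>L lborel g)" .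
  have G: "Gamma s \<noteq> 0"
    using assms by (auto simp: Gamma_eq_zero_iff elim!: nonpos_Ints_cases)
  have "s \<noteq> 1" "s - 1 \<notin> \<int>\<^sub>\<le>\<^sub>0"
    using assms by (auto elim!: nonpos_Ints_cases simp: complex_eq_iff)
  \<comment> \<open>After division by \<open>Gamma s\<close> this becomes the polar term
    \<open>1 / (s - 1)\<close>.\<close>
  hence G': "Gamma (s - 1) = Gamma s / (s - 1)"
    using Gamma_plus1[of "s - 1"] by (simp add: field_simps)
  have "(\<lambda>k. of_nat (k + 2) powr (- s)) sums (integral\<^sup>L lborel g / Gamma s)"
    using sums_divide[OF g(2), of "Gamma s"] G by simp
  moreover have "(\<lambda>n. cauchy2 (n + 1) * binomial_powr_sum 2 n s) sums
      (1 / (s - 1) - integral\<^sup>L lborel g / Gamma s)"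
    using sums_divide[OF *, of "Gamma s"] G by (simp add: G' diff_divide_distrib)
  ultimately show ?thesis by blast
qed

section \<open>Convergence and holomorphy on the whole plane\<close>

text \<open>A compact set lies in some half-plane \<open>Re s > - p\<close>, where
  \<open>binomial_powr_sum_bound\<close> gives a majorant of order \<open>n powr (- 3/2)\<close>. It
  serves both pointwise summability and the Weierstrass test.\<close>

lemma cauchy2_series_uniformly_summable:
  assumes "compact K"
  shows "\<exists>M. summable M \<and> (\<forall>s\<in>K. \<forall>n. norm (cauchy2 (n + 1) * binomial_powr_sum 2 n s) \<le> M n)"
proof -
  obtain b where b: "\<And>s. s \<in> K \<Longrightarrow> norm s \<le> b"
    using compact_imp_bounded[OF assms] by (auto simp: bounded_iff)
  obtain p where p: "b < real p" using reals_Archimedean2 by blast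
  have "Re s > - real p" if "s \<in> K" for s
    using b[OF that] p abs_Re_le_cmod[of s] by linarith
  then obtain B where B: "\<And>s n. s \<in> K \<Longrightarrow> norm (binomial_powr_sum 2 n s) \<le> B * real (n + 1) powr (1/2 - real 2)"
    using binomial_powr_sum_bound[OF assms, of p 2] by auto
  have "summable (\<lambda>n. B * real (n + 1) powr (1/2 - real 2))"
    by (intro summable_mult summable_real_Suc_powr) auto
  moreover have "norm (cauchy2 (n + 1) * binomial_powr_sum 2 n s) \<le> B * real (n + 1) powr (1/2 - real 2)"
    if "s \<in> K" for s n
  proof -
    have "norm (cauchy2 (n + 1) * binomial_powr_sum 2 n s) \<le> norm (binomial_powr_sum 2 n s)"
      unfolding norm_mult using norm_cauchy2_le_1 by (intro mult_left_le_one_le) auto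
    also note B[OF that]
    finally show ?thesis .
  qed
  ultimately show ?thesis by blast
qed

lemma summable_cauchy2_series: "summable (\<lambda>n. cauchy2 (n + 1) * binomial_powr_sum 2 n s)"
proof -
  obtain M where "summable M" "\<And>n. norm (cauchy2 (n + 1) * binomial_powr_sum 2 n s) \<le> M n"
    using cauchy2_series_uniformly_summable[of "{s}"] by auto
  thus ?thesis by (rule summable_comparison_test'[where N = 0])
qed

lemma holomorphic_cauchy2_series:
  "(\<lambda>s. \<Sum>n. cauchy2 (n + 1) * binomial_powr_sum 2 n s) holomorphic_on UNIV"
proof (rule holomorphic_uniform_sequence[where f = "\<lambda>N s. \<Sum>n<N. cauchy2 (n + 1) * binomial_powr_sum 2 n s"])
  show "\<exists>d>0. cball x d \<subseteq> UNIV \<and> uniform_limit (cball x d)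
          (\<lambda>N s. \<Sum>n<N. cauchy2 (n + 1) * binomial_powr_sum 2 n s)
          (\<lambda>s. \<Sum>n. cauchy2 (n + 1) * binomial_powr_sum 2 n s) sequentially" for x
  proof -
    obtain M where M: "summable M"
        "\<And>s n. s \<in> cball x 1 \<Longrightarrow> norm (cauchy2 (n + 1) * binomial_powr_sum 2 n s) \<le> M n"
      using cauchy2_series_uniformly_summable[of "cball x 1"] by auto
    show ?thesis
      by (intro exI[of _ 1] conjI Weierstrass_m_test[of _ _ M] M) auto
  qed
  show "(\<lambda>s. \<Sum>n<N. cauchy2 (n + 1) * binomial_powr_sum 2 n s) holomorphic_on UNIV" for N
    by (intro holomorphic_intros)
qed simp

section \<open>Identification with the zeta function\<close>

text \<open>Uniqueness for the definite description: two candidates agree on the open half-plane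
  \<open>Re s > 1\<close>, hence on the connected punctured plane, and the value at 1 is prescribed.
  Any function with these properties thus also settles existence.\<close>

lemma riemann_zeta_eqI:
  assumes "f holomorphic_on - {1}" "f 1 = 0"
    and "\<And>s. Re s > 1 \<Longrightarrow> (\<lambda>n. 1 / of_nat (Suc n) powr s) sums f s"
  shows "riemann_zeta = f"
  unfolding riemann_zeta_def
proof (rule the_equality)
  fix g :: "complex \<Rightarrow> complex"
  assume g: "g holomorphic_on - {1} \<and> g 1 = 0 \<and>
     (\<forall>s. Re s > 1 \<longrightarrow> (\<lambda>n. 1 / of_nat (Suc n) powr s) sums g s)"
  show "g = f"
  proof
    fix s :: complex
    show "g s = f s"
    proof (cases "s = 1")
      case False
      show ?thesis
      proof (rule analytic_continuation_open[of "{s. Re s > 1}" "- {1}" g f])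
        show "connected (- {1 :: complex})"
          by (intro connected_punctured_universe) auto
        show "{s. Re s > 1} \<noteq> {}"
          by (auto intro: exI[of _ 2])
        show "g z = f z" if "z \<in> {s. Re s > 1}" for z
          using that g assms(3)[of z] sums_unique2 by blast
      qed (use g assms False in \<open>auto simp: open_halfspace_Re_gt\<close>)
    qed (use g assms in auto)
  qed
qed (use assms in blast)

theorem theorem2:
  fixes s :: complex
  assumes "s \<noteq> 1"
  shows "summable (\<lambda>n. cauchy2 (n + 1) *
           (\<Sum>k=0..n. (- 1) ^ k * of_nat (n choose k) * of_nat (k + 2) powr (- s))) \<and>
    riemann_zeta s = 1 / (s - 1) + 1 - (\<Sum>n. cauchy2 (n + 1) *
           (\<Sum>k=0..n. (- 1) ^ k * of_nat (n choose k) * of_nat (k + 2) powr (- s)))"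
proof -
  define F where "F = (\<lambda>s. \<Sum>n. cauchy2 (n + 1) * binomial_powr_sum 2 n s)"
  \<comment> \<open>The candidate for the continuation; its value 0 at the pole follows the
    convention in \<open>riemann_zeta_def\<close>.\<close>
  define f where "f = (\<lambda>s. if s = 1 then 0 else 1 / (s - 1) + 1 - F s)"
  have zeta_eq: "riemann_zeta = f"
  proof (rule riemann_zeta_eqI)
    have "F holomorphic_on - {1}"
      unfolding F_def using holomorphic_cauchy2_series by (rule holomorphic_on_subset) auto
    hence "(\<lambda>s. 1 / (s - 1) + 1 - F s) holomorphic_on - {1}"
      by (intro holomorphic_intros) auto
    thus "f holomorphic_on - {1}"
      by (rule holomorphic_transform) (auto simp: f_def)
  next
    fix s :: complex assume s: "Re s > 1"
    obtain Z where Z: "(\<lambda>k. of_nat (k + 2) powr (- s)) sums Z" "F s = 1 / (s - 1) - Z"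
      using cauchy2_series_eq_zeta[OF s] by (auto simp: F_def sums_iff)
    have "(\<lambda>n. 1 / of_nat (Suc (Suc n)) powr s) sums Z"
      using Z(1) by (simp add: powr_minus_divide)
    \<comment> \<open>Prepending the first term of the Dirichlet series, which equals 1, accounts
      for the \<open>+ 1\<close> in the formula.\<close>
    hence "(\<lambda>n. 1 / of_nat (Suc n) powr s) sums (Z + 1 / of_nat (Suc 0) powr s)"
      by (rule sums_Suc)
    thus "(\<lambda>n. 1 / of_nat (Suc n) powr s) sums f s"
      using s Z(2) by (auto simp: f_def add.commute)
  qed (simp add: f_def)
  have "riemann_zeta s = 1 / (s - 1) + 1 - F s"
    using assms by (simp only: zeta_eq f_def if_False)
  thus ?thesis
    using summable_cauchy2_series[of s] unfolding F_def binomial_powr_sum_def by blast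
qed

end
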